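(* Let $p>3$ be a prime, let $a,b\in\mathbb{F}_p$, and let $L_{(p,a,b)}(\mathbb{F}_p)$ be the $7$-dimensional class-3 nilpotent $\mathbb{F}_p$-Lie algebra with basis $x_1,x_2,x_3,y_1,y_2,y_3,z$ and brackets $$[x_1,x_2]=y_1,\ [x_1,x_3]=y_2,\ [x_2,x_3]=y_3,\ [y_2,x_3]=[y_1,x_1]=z,\ [y_3,x_2]=bz,\ [y_3,x_3]=az.$$ (1) If $b\neq0$, then $$\zeta_{L_{(p,a,b)}(\mathbb{F}_p)}^{\triangleleft}(s)=1+(1+p+p^2)t+(1+p+p^2)t^2+(1+p+p^2+p^3)t^3+(1+p+p^2)t^4+(1+p+p^2)t^5+t^6+t^7.$$ (2) If $b=0$, then $$\zeta_{L_{(p,a,0)}(\mathbb{F}_p)}^{\triangleleft}(s)=1+(1+p+p^2)t+(1+p+p^2)t^2+(1+p+p^2+p^3)t^3+(1+p+p^2)t^4+(1+p+p^2)t^5+(1+p)t^6+t^7.$$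
   Context: All brackets of basis elements not listed are zero, up to antisymmetry. For an $n$-dimensional $\mathbb{F}_p$-Lie algebra $A$, $\zeta_{A}^{\triangleleft}(s)=\sum_{i=0}^{n}a_{p^i}^{\triangleleft}(A)\,t^{i}$, where $t=p^{-s}$ and $a_{p^i}^{\triangleleft}(A)$ is the number of Lie ideals of $A$ of codimension $i$. *)

theory Defs
  imports "HOL-Analysis.Analysis" "Berlekamp_Zassenhaus.Finite_Field"
begin

section \<open>Lie algebras over a field\<close>

locale lie_algebra = vector_space scale
  for scale :: "'k::field \<Rightarrow> 'v::ab_group_add \<Rightarrow> 'v" +
  fixes bracket :: "'v \<Rightarrow> 'v \<Rightarrow> 'v"
  assumes bracket_add_left: "bracket (x + y) z = bracket x z + bracket y z"
    and bracket_add_right: "bracket x (y + z) = bracket x y + bracket x z"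
    and bracket_scale_left: "bracket (scale c x) y = scale c (bracket x y)"
    and bracket_scale_right: "bracket x (scale c y) = scale c (bracket x y)"
    and bracket_self: "bracket x x = 0"
    and jacobi: "bracket (bracket x y) z + bracket (bracket y z) x + bracket (bracket z x) y = 0"
begin

definition lie_ideal :: "'v set \<Rightarrow> bool" where
  "lie_ideal I \<longleftrightarrow> subspace I \<and> (\<forall>x\<in>I. \<forall>y. bracket x y \<in> I)"

primrec lower_central :: "nat \<Rightarrow> 'v set" where
  "lower_central 0 = UNIV"
| "lower_central (Suc n) = span {bracket x y | x y. x \<in> lower_central n}"

definition nilpotent_of_class :: "nat \<Rightarrow> bool" where
  "nilpotent_of_class c \<longleftrightarrow> lower_central c = {0} \<and> (\<forall>d<c. lower_central d \<noteq> {0})"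

end

section \<open>The ideal zeta function of a finite-dimensional Lie algebra over a prime field\<close>

text \<open>The field with \<open>p\<close> elements is \<open>'p mod_ring\<close>, where \<open>CARD('p) = p\<close>
  and \<open>'p :: prime_card\<close> says that \<open>p\<close> is prime.\<close>

locale Fp_lie_algebra = lie_algebra scale bracket
  for scale :: "'p::prime_card mod_ring \<Rightarrow> 'v::ab_group_add \<Rightarrow> 'v"
    and bracket :: "'v \<Rightarrow> 'v \<Rightarrow> 'v" +
  assumes finite_dim: "\<exists>B. finite B \<and> span B = UNIV"
begin

definition num_ideals_codim :: "nat \<Rightarrow> nat" where
  "num_ideals_codim i = card {I. lie_ideal I \<and> dim I + i = dim (UNIV :: 'v set)}"

definition ideal_zeta :: "complex \<Rightarrow> complex" where
  "ideal_zeta s =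
    (\<Sum>i = 0..dim (UNIV :: 'v set). of_nat (num_ideals_codim i) * (of_nat CARD('p) powr (- s)) ^ i)"

end

section \<open>The Lie algebras $L_{(p,a,b)}$\<close>

datatype gen = X1 | X2 | X3 | Y1 | Y2 | Y3 | Z

lemma UNIV_gen: "(UNIV :: gen set) = {X1, X2, X3, Y1, Y2, Y3, Z}"
  using gen.exhaust by blast

instance gen :: finite
  by standard (simp add: UNIV_gen)

lemma CARD_gen: "CARD(gen) = 7"
  by (simp add: UNIV_gen)

abbreviation e :: "gen \<Rightarrow> 'k::field ^ gen" where
  "e g \<equiv> axis g 1"

text \<open>Only one order of each pair is listed; \<open>basis_bracket\<close> adds the reversed brackets.\<close>

fun listed_bracket :: "'k::field \<Rightarrow> 'k \<Rightarrow> gen \<Rightarrow> gen \<Rightarrow> 'k ^ gen" where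
  "listed_bracket a b X1 X2 = e Y1"
| "listed_bracket a b X1 X3 = e Y2"
| "listed_bracket a b X2 X3 = e Y3"
| "listed_bracket a b Y2 X3 = e Z"
| "listed_bracket a b Y1 X1 = e Z"
| "listed_bracket a b Y3 X2 = b *s e Z"
| "listed_bracket a b Y3 X3 = a *s e Z"
| "listed_bracket a b _ _ = 0"

definition basis_bracket :: "'k::field \<Rightarrow> 'k \<Rightarrow> gen \<Rightarrow> gen \<Rightarrow> 'k ^ gen" where
  "basis_bracket a b g h = listed_bracket a b g h - listed_bracket a b h g"

definition L_bracket :: "'k::field \<Rightarrow> 'k \<Rightarrow> 'k ^ gen \<Rightarrow> 'k ^ gen \<Rightarrow> 'k ^ gen" where
  "L_bracket a b u v = (\<Sum>g\<in>UNIV. \<Sum>h\<in>UNIV. (u $ g * v $ h) *s basis_bracket a b g h)"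

lemma axis_nth_gen: "axis g c $ h = (if g = h then c else 0)"
  by (simp add: axis_def)

lemma sum_gen: "(\<Sum>g\<in>UNIV. f g) = f X1 + f X2 + f X3 + f Y1 + f Y2 + f Y3 + f Z"
  for f :: "gen \<Rightarrow> 'c::comm_monoid_add"
  by (simp add: UNIV_gen add.assoc)

lemma L_bracket_nth_sum:
  "L_bracket a b u v $ k =
    (\<Sum>g\<in>UNIV. \<Sum>h\<in>UNIV. (u $ g * v $ h - u $ h * v $ g) * listed_bracket a b g h $ k)"
proof -
  let ?l = "listed_bracket a b"
  have "L_bracket a b u v $ k =
      (\<Sum>g\<in>UNIV. \<Sum>h\<in>UNIV. u $ g * v $ h * ?l g h $ k) -
      (\<Sum>g\<in>UNIV. \<Sum>h\<in>UNIV. u $ g * v $ h * ?l h g $ k)"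
    by (simp add: L_bracket_def basis_bracket_def right_diff_distrib sum_subtractf)
  also have "(\<Sum>g\<in>UNIV. \<Sum>h\<in>UNIV. u $ g * v $ h * ?l h g $ k) =
      (\<Sum>g\<in>UNIV. \<Sum>h\<in>UNIV. u $ h * v $ g * ?l g h $ k)"
    by (rule sum.swap)
  finally show ?thesis
    by (simp add: left_diff_distrib sum_subtractf)
qed

lemma listed_bracket_row:
  fixes f :: "gen \<Rightarrow> 'k::field"
  shows
    "(\<Sum>h\<in>UNIV. f h * listed_bracket a b X1 h $ k) = f X2 * e Y1 $ k + f X3 * e Y2 $ k"
    "(\<Sum>h\<in>UNIV. f h * listed_bracket a b X2 h $ k) = f X3 * e Y3 $ k"
    "(\<Sum>h\<in>UNIV. f h * listed_bracket a b X3 h $ k) = 0"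
    "(\<Sum>h\<in>UNIV. f h * listed_bracket a b Y1 h $ k) = f X1 * e Z $ k"
    "(\<Sum>h\<in>UNIV. f h * listed_bracket a b Y2 h $ k) = f X3 * e Z $ k"
    "(\<Sum>h\<in>UNIV. f h * listed_bracket a b Y3 h $ k) = f X2 * (b * e Z $ k) + f X3 * (a * e Z $ k)"
    "(\<Sum>h\<in>UNIV. f h * listed_bracket a b Z h $ k) = 0"
  by (simp_all add: sum_gen)

lemma L_bracket_nth:
  "L_bracket a b u v $ X1 = 0"
  "L_bracket a b u v $ X2 = 0"
  "L_bracket a b u v $ X3 = 0"
  "L_bracket a b u v $ Y1 = u $ X1 * v $ X2 - u $ X2 * v $ X1"
  "L_bracket a b u v $ Y2 = u $ X1 * v $ X3 - u $ X3 * v $ X1"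
  "L_bracket a b u v $ Y3 = u $ X2 * v $ X3 - u $ X3 * v $ X2"
  "L_bracket a b u v $ Z =
     (u $ Y2 * v $ X3 - u $ X3 * v $ Y2) + (u $ Y1 * v $ X1 - u $ X1 * v $ Y1)
     + b * (u $ Y3 * v $ X2 - u $ X2 * v $ Y3) + a * (u $ Y3 * v $ X3 - u $ X3 * v $ Y3)"
  unfolding L_bracket_nth_sum sum_gen[of "\<lambda>g. sum (F g) UNIV" for F] listed_bracket_row
  by (simp_all add: axis_nth_gen mult.commute)

lemma vec_gen_eq_iff:
  "u = v \<longleftrightarrow> u $ X1 = v $ X1 \<and> u $ X2 = v $ X2 \<and> u $ X3 = v $ X3 \<and>
    u $ Y1 = v $ Y1 \<and> u $ Y2 = v $ Y2 \<and> u $ Y3 = v $ Y3 \<and> u $ Z = v $ Z"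
proof -
  have "(\<forall>g. P g) \<longleftrightarrow> P X1 \<and> P X2 \<and> P X3 \<and> P Y1 \<and> P Y2 \<and> P Y3 \<and> P Z" for P
    by (simp add: UNIV_gen flip: ball_UNIV)
  then show ?thesis by (simp only: vec_eq_iff)
qed

lemma L_bracket_basis: "L_bracket a b (e g) (e h) = basis_bracket a b g h"
proof -
  have "(\<Sum>j\<in>UNIV. (e g $ i * e h $ j) *s basis_bracket a b i j) =
      (if i = g then basis_bracket a b g h else 0)" for i
  proof -
    have "(e g $ i * e h $ j) *s basis_bracket a b i j =
        (if j = h then if i = g then basis_bracket a b g h else 0 else 0)" for j
      by (simp add: axis_nth_gen)
    then show ?thesis by simp
  qed
  then show ?thesis by (simp add: L_bracket_def)
qed

lemma L_lie_algebra: "lie_algebra (*s) (L_bracket a b)"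
  by (intro lie_algebra.intro lie_algebra_axioms.intro vec.vector_space_axioms)
    (simp_all add: vec_gen_eq_iff L_bracket_nth algebra_simps)

lemma L_Fp_lie_algebra: "Fp_lie_algebra (*s) (L_bracket a b)"
  for a b :: "'p::prime_card mod_ring"
proof -
  interpret lie_algebra "(*s)" "L_bracket a b" by (rule L_lie_algebra)
  show ?thesis
    by unfold_locales (use finite_cart_basis span_cart_basis in blast)
qed

lemma L_dim: "vec.dim (UNIV :: ('k::field ^ gen) set) = 7"
  by (simp add: vec.dim_UNIV vec.dimension_def card_cart_basis CARD_gen)

lemma L_nilpotent_of_class_3: "lie_algebra.nilpotent_of_class (*s) (L_bracket a b) 3"
  for a b :: "'k::field"
proof -
  interpret L: lie_algebra "(*s)" "L_bracket a b" by (rule L_lie_algebra)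
  let ?lc = "lie_algebra.lower_central (*s) (L_bracket a b)"
  have lc_Suc: "?lc (Suc n) = vec.span {L_bracket a b x y | x y. x \<in> ?lc n}" for n
    by (rule L.lower_central.simps(2))
  have le: "?lc (Suc n) \<subseteq> S"
    if "vec.subspace S" "\<And>x y. x \<in> ?lc n \<Longrightarrow> L_bracket a b x y \<in> S" for n S
    unfolding lc_Suc using that by (intro vec.span_minimal) auto
  have mem: "L_bracket a b x y \<in> ?lc (Suc n)" if "x \<in> ?lc n" for n x y
    unfolding lc_Suc using that by (intro vec.span_base) auto
  have le1: "?lc (Suc 0) \<subseteq> {u. u $ X1 = 0 \<and> u $ X2 = 0 \<and> u $ X3 = 0}" (is "_ \<subseteq> ?S1")
    by (rule le) (auto simp: vec.subspace_def L_bracket_nth)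
  have le2: "?lc (Suc (Suc 0)) \<subseteq> {u. u $ X1 = 0 \<and> u $ X2 = 0 \<and> u $ X3 = 0 \<and>
      u $ Y1 = 0 \<and> u $ Y2 = 0 \<and> u $ Y3 = 0}"
    by (rule le) (use le1 in \<open>auto simp: vec.subspace_def L_bracket_nth\<close>)
  have "?lc (Suc (Suc (Suc 0))) \<subseteq> {0}"
    by (rule le) (use le2 in \<open>auto simp: vec_gen_eq_iff L_bracket_nth\<close>)
  then have lc3: "?lc 3 = {0}"
    using vec.span_zero by (auto simp: numeral_3_eq_3 lc_Suc)
  have nonzero: "e g \<noteq> (0 :: 'k ^ gen)" for g
    by (simp add: axis_eq_0_iff)
  have y: "e Y1 \<in> ?lc (Suc 0)"
    using mem[of "e X1" 0 "e X2"] by (simp add: L_bracket_basis basis_bracket_def)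
  have z: "e Z \<in> ?lc (Suc (Suc 0))"
    using mem[OF y, of "e X1"] by (simp add: L_bracket_basis basis_bracket_def)
  have "?lc d \<noteq> {0}" if "d < 3" for d
  proof -
    have "d = 0 \<or> d = Suc 0 \<or> d = Suc (Suc 0)" using that by arith
    moreover have "e Y1 \<in> ?lc 0" by simp
    ultimately show ?thesis
      using y z nonzero[of Y1] nonzero[of Z] by (metis singletonD)
  qed
  with lc3 show ?thesis by (simp add: L.nilpotent_of_class_def)
qed

end

theory Submission
  imports Defs
begin

text \<open>Write \<open>Z\<close> for the line spanned by \<open>z\<close>. An ideal \<open>I\<close> containing some \<open>u \<notin> L'\<close> contains
  \<open>[[u, L], L] = Z\<close> and the three-dimensional space \<open>K = [u, L] + Z\<close>. If in addition \<open>L'\<close> is not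
  contained in \<open>I\<close>, then \<open>I \<inter> L' = K\<close>, and \<open>[I, L] \<subseteq> K\<close> forces \<open>I\<close> to be the four-dimensional
  ideal generated by \<open>u\<close>. An ideal inside \<open>L'\<close> either contains \<open>Z\<close> or lies in the centre, whose
  dimension depends on \<open>b\<close>. Conversely, every subspace of the centre, between \<open>Z\<close> and \<open>L'\<close>, or
  above \<open>L'\<close> is an ideal. So in dimensions other than 4 one counts the subspaces of an interval;
  in dimension 4 each vector outside \<open>L'\<close> generates exactly one of the ideals other than \<open>L'\<close>.\<close>

section \<open>Counting subspaces over a finite field\<close>

text \<open>As \<open>x\<close> lies outside the span, the representation \<open>c *s x + w\<close>
  is unique: two different coefficients would let one solve for \<open>x\<close>.\<close>

lemma card_span_insert:
  fixes x :: "'k::{field,finite} ^ 'n::finite"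
  assumes "x \<notin> vec.span S"
  shows "card (vec.span (insert x S)) = CARD('k) * card (vec.span S)"
proof -
  let ?f = "\<lambda>(c, w). c *s x + w"
  have "inj_on ?f (UNIV \<times> vec.span S)"
  proof (rule inj_onI, clarify)
    fix c w d v
    assume w: "w \<in> vec.span S" and v: "v \<in> vec.span S" and eq: "c *s x + w = d *s x + v"
    from eq have "(c - d) *s x = v - w" by (simp add: vec.scale_left_diff_distrib algebra_simps)
    then have "(c - d) *s x \<in> vec.span S" using w v by (simp add: vec.span_diff)
    then have "inverse (c - d) *s ((c - d) *s x) \<in> vec.span S" by (rule vec.span_scale)
    with assms have "c = d"
      by (cases "c = d")
        (simp_all add: vec.scale_scale del: vec.scale_left_diff_distrib vector_sub_rdistrib)
    with eq show "c = d \<and> w = v" by simp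
  qed
  moreover have "?f ` (UNIV \<times> vec.span S) = vec.span (insert x S)"
  proof (intro equalityI subsetI)
    fix y assume "y \<in> ?f ` (UNIV \<times> vec.span S)"
    then obtain c w where "w \<in> vec.span S" "y = c *s x + w" by auto
    then show "y \<in> vec.span (insert x S)"
      by (auto simp: vec.span_insert intro!: exI[of _ c])
  next
    fix y assume "y \<in> vec.span (insert x S)"
    then obtain c where "y - c *s x \<in> vec.span S" by (auto simp: vec.span_insert)
    then show "y \<in> ?f ` (UNIV \<times> vec.span S)"
      by (intro image_eqI[of _ _ "(c, y - c *s x)"]) auto
  qed
  ultimately show ?thesis
    by (metis card_image card_cartesian_product)
qed

lemma card_subspace:
  fixes S :: "('k::{field,finite} ^ 'n::finite) set"
  assumes "vec.subspace S"
  shows "card S = CARD('k) ^ vec.dim S"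
proof -
  have *: "card (vec.span B) = CARD('k) ^ card B" if "finite B" "vec.independent B"
    for B :: "('k ^ 'n) set"
    using that
  proof induction
    case (insert x B)
    then have "x \<notin> vec.span B" "vec.independent B"
      by (auto simp: vec.independent_insert split: if_splits)
    with insert show ?case by (simp add: card_span_insert)
  qed simp
  obtain B where "B \<subseteq> S" "vec.independent B" "S \<subseteq> vec.span B" "card B = vec.dim S"
    using vec.basis_exists by blast
  with assms have "vec.span B = S" by (simp add: vec.span_subspace)
  with * \<open>vec.independent B\<close> \<open>card B = vec.dim S\<close> show ?thesis
    by (metis vec.independent_bound_general vec.finiteI_independent)
qed

text \<open>Double counting of the incidences \<open>u \<in> I\<close>. It serves families whose
  members partition \<open>U\<close>, once for subspaces just above \<open>A\<close> and once for
  the ideals of dimension 4.\<close>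

lemma card_mult_eq_of_unique:
  assumes "finite F" "finite U" and "\<And>I. I \<in> F \<Longrightarrow> card {u \<in> U. u \<in> I} = m"
    and "\<And>u. u \<in> U \<Longrightarrow> \<exists>!I. I \<in> F \<and> u \<in> I"
  shows "card F * m = card U"
proof -
  have "card {I \<in> F. u \<in> I} = 1" if "u \<in> U" for u
    using assms(4)[OF that] by (auto simp: card_1_singleton_iff)
  then have "(\<Sum>u\<in>U. card {I \<in> F. u \<in> I}) = card U" by simp
  moreover have "(\<Sum>u\<in>U. card {I \<in> F. u \<in> I}) = m * card F"
    using assms by (intro sum_multicount) auto
  ultimately show ?thesis by (simp add: mult.commute)
qed

lemma dim_span_insert:
  assumes "x \<notin> S" "vec.subspace S"
  shows "vec.dim (vec.span (insert x S)) = Suc (vec.dim S)"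
proof -
  have "x \<notin> vec.span S" using assms by (metis vec.span_eq_iff)
  then show ?thesis by (simp add: vec.dim_insert)
qed

lemma card_ge_2_field: "CARD('k::{field,finite}) \<ge> 2"
  using card_mono[of "UNIV :: 'k set" "{0, 1}"] by simp

text \<open>Each \<open>u\<close> in \<open>B - A\<close> lies in exactly one such subspace, the
  span of \<open>u\<close> and \<open>A\<close>. Hence the sets \<open>I - A\<close> partition
  \<open>B - A\<close>, and the quotient of cardinalities is a geometric sum.\<close>

lemma card_subspaces_Suc_dim:
  fixes A B :: "('k::{field,finite} ^ 'n::finite) set"
  assumes A: "vec.subspace A" and B: "vec.subspace B" and "A \<subseteq> B"
    and dim: "vec.dim B = vec.dim A + d"
  shows "card {I. vec.subspace I \<and> A \<subseteq> I \<and> I \<subseteq> B \<and> vec.dim I = Suc (vec.dim A)}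
    = (\<Sum>i<d. CARD('k) ^ i)" (is "card ?F = _")
proof -
  let ?q = "CARD('k)"
  let ?a = "vec.dim A"
  have diff: "card (I - A) = ?q ^ vec.dim I - ?q ^ ?a" if "vec.subspace I" "A \<subseteq> I" for I
    using that A by (simp add: card_Diff_subset card_subspace)
  have "card ?F * (?q ^ Suc ?a - ?q ^ ?a) = card (B - A)"
  proof (rule card_mult_eq_of_unique)
    fix I assume I: "I \<in> ?F"
    then have "{u \<in> B - A. u \<in> I} = I - A" by auto
    with I diff[of I] show "card {u \<in> B - A. u \<in> I} = ?q ^ Suc ?a - ?q ^ ?a" by simp
  next
    fix u assume u: "u \<in> B - A"
    let ?I = "vec.span (insert u A)"
    have dimI: "vec.dim ?I = Suc ?a" using u A dim_span_insert by blast
    show "\<exists>!I. I \<in> ?F \<and> u \<in> I"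
    proof (rule ex1I[of _ ?I])
      have "?I \<subseteq> B" using u \<open>A \<subseteq> B\<close> B by (intro vec.span_minimal) auto
      with dimI show "?I \<in> ?F \<and> u \<in> ?I" by (auto simp: vec.span_base)
    next
      fix J assume J: "J \<in> ?F \<and> u \<in> J"
      then have "?I \<subseteq> J" by (intro vec.span_minimal) auto
      with J dimI show "J = ?I"
        by (intro vec.subspace_dim_equal[symmetric]) auto
    qed
  qed auto
  also have "card (B - A) = ?q ^ ?a * (?q ^ d - 1)"
    using diff[OF B \<open>A \<subseteq> B\<close>] by (simp add: dim power_add diff_mult_distrib2)
  \<comment> \<open>The identity is transferred to the integers because subtraction on
    \<open>nat\<close> is truncated.\<close>
  also have "?q ^ d - 1 = (?q - 1) * (\<Sum>i<d. ?q ^ i)"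
    by (simp flip: of_nat_eq_iff[where 'a=int] add: power_diff_1_eq of_nat_diff)
  finally have "?q ^ ?a * (?q - 1) * card ?F = ?q ^ ?a * (?q - 1) * (\<Sum>i<d. ?q ^ i)"
    by (simp add: diff_mult_distrib diff_mult_distrib2 mult_ac)
  then show ?thesis using card_ge_2_field[where 'k='k] by simp
qed

text \<open>Double counting of the flags \<open>A < J < I \<le> B\<close>.\<close>

lemma card_subspaces_Suc_Suc_dim:
  fixes A B :: "('k::{field,finite} ^ 'n::finite) set"
  assumes A: "vec.subspace A" and B: "vec.subspace B" and "A \<subseteq> B"
    and dim: "vec.dim B = vec.dim A + 3"
  shows "card {I. vec.subspace I \<and> A \<subseteq> I \<and> I \<subseteq> B \<and> vec.dim I = vec.dim A + 2}
    = 1 + CARD('k) + CARD('k)\<^sup>2" (is "card ?P = _")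
proof -
  let ?q = "CARD('k)"
  let ?L = "{J. vec.subspace J \<and> A \<subseteq> J \<and> J \<subseteq> B \<and> vec.dim J = Suc (vec.dim A)}"
  have "card {J \<in> ?L. J \<subseteq> I} = 1 + ?q" if "I \<in> ?P" for I
  proof -
    have "{J \<in> ?L. J \<subseteq> I} =
        {J. vec.subspace J \<and> A \<subseteq> J \<and> J \<subseteq> I \<and> vec.dim J = Suc (vec.dim A)}"
      using that by auto
    with that show ?thesis
      using card_subspaces_Suc_dim[of A I 2] A by (simp add: numeral_2_eq_2)
  qed
  then have "(\<Sum>J\<in>?L. card {I \<in> ?P. J \<subseteq> I}) = (1 + ?q) * card ?P"
    by (intro sum_multicount) auto
  \<comment> \<open>Seen from either end of the flag, the remaining interval has length 2, so both
    fibres have \<open>1 + ?q\<close> elements and this factor cancels at the end.\<close>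
  moreover have "card {I \<in> ?P. J \<subseteq> I} = 1 + ?q" if "J \<in> ?L" for J
  proof -
    have "{I \<in> ?P. J \<subseteq> I} =
        {I. vec.subspace I \<and> J \<subseteq> I \<and> I \<subseteq> B \<and> vec.dim I = Suc (vec.dim J)}"
      using that by auto
    with that dim show ?thesis
      using card_subspaces_Suc_dim[of J B 2] B by (simp add: numeral_2_eq_2)
  qed
  moreover have "card ?L = 1 + ?q + ?q\<^sup>2"
    using card_subspaces_Suc_dim[OF A B \<open>A \<subseteq> B\<close> dim]
    by (simp add: numeral_3_eq_3 power2_eq_square)
  ultimately have "(1 + ?q) * card ?P = (1 + ?q) * (1 + ?q + ?q\<^sup>2)"
    by (simp only: sum_constant mult.commute of_nat_id cong: sum.cong)
  then show ?thesis by (subst (asm) mult_left_cancel) simp_all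
qed

section \<open>The ideals of \<open>L\<^bsub>(p,a,b)\<^esub>\<close>\<close>

abbreviation L_ideal :: "'k::field \<Rightarrow> 'k \<Rightarrow> ('k ^ gen) set \<Rightarrow> bool" where
  "L_ideal a b \<equiv> lie_algebra.lie_ideal (*s) (L_bracket a b)"

lemma L_ideal_iff:
  "L_ideal a b I \<longleftrightarrow> vec.subspace I \<and> (\<forall>x\<in>I. \<forall>y. L_bracket a b x y \<in> I)"
proof -
  interpret lie_algebra "(*s)" "L_bracket a b" by (rule L_lie_algebra)
  show ?thesis by (rule lie_ideal_def)
qed

section \<open>The derived algebra, the line of z, the centre and the wedge kernel\<close>

definition L_derived :: "('k::field ^ gen) set" where
  "L_derived = {u. u $ X1 = 0 \<and> u $ X2 = 0 \<and> u $ X3 = 0}"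

definition Z_line :: "('k::field ^ gen) set" where
  "Z_line = {u \<in> L_derived. u $ Y1 = 0 \<and> u $ Y2 = 0 \<and> u $ Y3 = 0}"

text \<open>The three equations on the Y-coordinates are the vanishing of the z-coordinates of
  \<open>[u, x_1]\<close>, \<open>[u, x_2]\<close> and \<open>[u, x_3]\<close>, in this
  order.\<close>

definition L_centre :: "'k::field \<Rightarrow> 'k \<Rightarrow> ('k ^ gen) set" where
  "L_centre a b = {u \<in> L_derived. u $ Y1 = 0 \<and> b * u $ Y3 = 0 \<and> u $ Y2 + a * u $ Y3 = 0}"

text \<open>Identifying \<open>L' / Z\<close> with the exterior square of \<open>L / L'\<close> by the bracket, this is the wedge
  product of the class of \<open>u\<close> in \<open>L / L'\<close> and the class of \<open>w\<close> in \<open>L' / Z\<close>.\<close>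

definition wedge :: "'k::field ^ gen \<Rightarrow> 'k ^ gen \<Rightarrow> 'k" where
  "wedge u w = u $ X1 * w $ Y3 - u $ X2 * w $ Y2 + u $ X3 * w $ Y1"

text \<open>For \<open>u\<close> outside \<open>L'\<close> this is the space
  \<open>K = [u, L] + Z\<close>. The inclusion of \<open>K\<close> in it is easy;
  \<open>wedge_ker_cover\<close> gives the converse.\<close>

definition wedge_ker :: "'k::field ^ gen \<Rightarrow> ('k ^ gen) set" where
  "wedge_ker u = {w \<in> L_derived. wedge u w = 0}"

lemma wedge_minus_scale: "wedge u (w - c *s v) = wedge u w - c * wedge u v"
  by (simp add: wedge_def algebra_simps)

lemma subspace_L_derived: "vec.subspace L_derived"
  by (simp add: vec.subspace_def L_derived_def)

lemma subspace_Z_line: "vec.subspace Z_line"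
  by (simp add: vec.subspace_def Z_line_def L_derived_def)

lemma subspace_L_centre: "vec.subspace (L_centre a b)"
  by (auto simp: vec.subspace_def L_centre_def L_derived_def algebra_simps)
    (metis add_cancel_left_left add.assoc add.commute distrib_left
      mult_zero_right mult.left_commute)+

lemma subspace_wedge_ker: "vec.subspace (wedge_ker u)"
proof -
  have "wedge u (v + w) = wedge u v + wedge u w" "wedge u (c *s w) = c * wedge u w"
    "wedge u 0 = 0" for v w c
    by (simp_all add: wedge_def algebra_simps)
  then show ?thesis
    using subspace_L_derived by (auto simp: vec.subspace_def wedge_ker_def)
qed

lemma Z_line_subset_L_centre: "Z_line \<subseteq> L_centre a b"
  by (auto simp: Z_line_def L_centre_def)

lemma L_centre_subset_L_derived: "L_centre a b \<subseteq> L_derived"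
  by (auto simp: L_centre_def)

lemma Z_line_subset_L_derived: "Z_line \<subseteq> L_derived"
  by (auto simp: Z_line_def)

lemma Z_line_subset_wedge_ker: "Z_line \<subseteq> wedge_ker u"
  by (auto simp: Z_line_def wedge_ker_def wedge_def)

lemma wedge_ker_subset_L_derived: "wedge_ker u \<subseteq> L_derived"
  by (auto simp: wedge_ker_def)

lemma L_bracket_in_L_derived: "L_bracket a b u v \<in> L_derived"
  by (simp add: L_derived_def L_bracket_nth)

lemma L_bracket_in_Z_line: "u \<in> L_derived \<Longrightarrow> L_bracket a b u v \<in> Z_line"
  by (simp add: L_derived_def Z_line_def L_bracket_nth)

lemma L_bracket_L_centre: "u \<in> L_centre a b \<Longrightarrow> L_bracket a b u v = 0"
proof -
  assume "u \<in> L_centre a b"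
  then have u: "u $ X1 = 0" "u $ X2 = 0" "u $ X3 = 0" "u $ Y1 = 0" "b * u $ Y3 = 0"
    "u $ Y2 = - (a * u $ Y3)"
    by (auto simp: L_centre_def L_derived_def eq_neg_iff_add_eq_0)
  from u(5) have "b * (u $ Y3 * v $ X2) = 0" by auto
  with u show ?thesis by (simp add: vec_gen_eq_iff L_bracket_nth)
qed

text \<open>In the exterior algebra of \<open>L / L'\<close> this is the vanishing of u wedge (u
  wedge v).\<close>

lemma L_bracket_in_wedge_ker: "L_bracket a b u v \<in> wedge_ker u"
  using L_bracket_in_L_derived
  by (simp add: wedge_ker_def wedge_def L_bracket_nth algebra_simps)

lemma dim_L_derived: "vec.dim (L_derived :: ('k::field ^ gen) set) = 4"
proof -
  have *: "L_derived = {u :: 'k ^ gen. \<forall>g. g \<notin> {Y1, Y2, Y3, Z} \<longrightarrow> u $ g = 0}"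
    unfolding L_derived_def
    by (metis (no_types, opaque_lifting) gen.exhaust gen.distinct insert_iff empty_iff)
  show ?thesis unfolding * dim_substandard_cart by simp
qed

lemma dim_Z_line: "vec.dim (Z_line :: ('k::field ^ gen) set) = 1"
proof -
  have *: "Z_line = {u :: 'k ^ gen. \<forall>g. g \<notin> {Z} \<longrightarrow> u $ g = 0}"
    unfolding Z_line_def L_derived_def
    by auto (metis gen.exhaust)
  show ?thesis unfolding * dim_substandard_cart by simp
qed

text \<open>On the four-dimensional \<open>L'\<close> the map \<open>wedge u\<close> is a nonzero
  linear form, with kernel a hyperplane.\<close>

lemma dim_wedge_ker:
  fixes u :: "'k::field ^ gen"
  assumes "u \<notin> L_derived"
  shows "vec.dim (wedge_ker u) = 3"
proof -
  \<comment> \<open>The coefficients of the form are, up to sign, the coordinates of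
    \<open>u\<close> modulo \<open>L'\<close>, so one of them is nonzero.\<close>
  have "wedge u (e Y3) = u $ X1" "wedge u (e Y2) = - u $ X2" "wedge u (e Y1) = u $ X3"
    "e Y1 \<in> L_derived" "e Y2 \<in> L_derived" "e Y3 \<in> L_derived"
    by (simp_all add: wedge_def axis_nth_gen L_derived_def)
  with assms obtain w where w: "w \<in> L_derived" "wedge u w \<noteq> 0"
    unfolding L_derived_def by (metis (mono_tags, lifting) mem_Collect_eq neg_equal_0_iff_equal)
  have "v \<in> vec.span (insert w (wedge_ker u))" if "v \<in> L_derived" for v
  proof -
    have "v - (wedge u v / wedge u w) *s w \<in> wedge_ker u"
      using that w
      by (simp add: wedge_ker_def wedge_minus_scale vec.subspace_diff vec.subspace_scale subspace_L_derived)
    then show ?thesis unfolding vec.span_insert using vec.span_base by blast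
  qed
  moreover have "vec.span (insert w (wedge_ker u)) \<subseteq> L_derived"
    using w wedge_ker_subset_L_derived subspace_L_derived by (intro vec.span_minimal) auto
  ultimately have "vec.span (insert w (wedge_ker u)) = L_derived" by blast
  moreover have "w \<notin> wedge_ker u" using w by (simp add: wedge_ker_def)
  ultimately show ?thesis
    using dim_span_insert[OF _ subspace_wedge_ker, of w u] dim_L_derived[where 'k='k] by simp
qed

section \<open>Ideals containing a vector outside L'\<close>

lemma Z_line_subsetI:
  assumes "vec.subspace I" "v \<in> I" "v \<in> Z_line" "v $ Z \<noteq> 0"
  shows "Z_line \<subseteq> I"
proof
  fix w :: "'a ^ gen" assume "w \<in> Z_line"
  with assms have "w = (w $ Z / v $ Z) *s v"
    by (simp add: vec_gen_eq_iff Z_line_def L_derived_def)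
  with assms show "w \<in> I" by (metis vec.subspace_scale)
qed

text \<open>For \<open>u\<close> outside \<open>L'\<close> this is the ideal generated by
  \<open>u\<close>: it is an ideal by \<open>L_ideal_L_wedge_ideal\<close>, and
  \<open>wedge_ker_subset_L_ideal\<close> makes it the least one containing
  \<open>u\<close>.\<close>

definition L_wedge_ideal :: "'k::field ^ gen \<Rightarrow> ('k ^ gen) set" where
  "L_wedge_ideal u = vec.span (insert u (wedge_ker u))"

lemma mem_L_wedge_ideal: "v \<in> L_wedge_ideal u \<longleftrightarrow> (\<exists>c. v - c *s u \<in> wedge_ker u)"
  using subspace_wedge_ker[of u] by (simp add: L_wedge_ideal_def vec.span_insert flip: vec.span_eq_iff)

lemma dim_L_wedge_ideal:
  fixes u :: "'k::field ^ gen"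
  assumes "u \<notin> L_derived"
  shows "vec.dim (L_wedge_ideal u) = 4"
  unfolding L_wedge_ideal_def
  using dim_span_insert[OF _ subspace_wedge_ker, of u u] dim_wedge_ker[OF assms]
    wedge_ker_subset_L_derived assms by auto

lemma L_wedge_ideal_Int_L_derived:
  assumes "u \<notin> L_derived"
  shows "L_wedge_ideal u \<inter> L_derived = wedge_ker u"
proof (intro equalityI subsetI)
  fix v assume "v \<in> L_wedge_ideal u \<inter> L_derived"
  then obtain c where c: "v - c *s u \<in> wedge_ker u" and v: "v \<in> L_derived"
    by (auto simp: mem_L_wedge_ideal)
  from c have "v - c *s u \<in> L_derived" by (simp add: wedge_ker_def)
  with v assms have "c = 0" by (auto simp: L_derived_def)
  with c show "v \<in> wedge_ker u" by simp
next
  fix v assume "v \<in> wedge_ker u"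
  then show "v \<in> L_wedge_ideal u \<inter> L_derived"
    using wedge_ker_subset_L_derived by (auto simp: L_wedge_ideal_def vec.span_base)
qed

text \<open>A bivector killed by wedging with a nonzero vector \<open>u\<close> is divisible by
  \<open>u\<close>; here this holds modulo \<open>Z\<close>.\<close>

lemma wedge_ker_cover:
  fixes u w :: "'k::field ^ gen"
  assumes u: "u \<notin> L_derived" and w: "w \<in> wedge_ker u"
  obtains v where "w - L_bracket a b u v \<in> Z_line"
proof -
  have w': "w \<in> L_derived" "u $ X1 * w $ Y3 - u $ X2 * w $ Y2 + u $ X3 * w $ Y1 = 0"
    using w by (auto simp: wedge_ker_def wedge_def)
  have mem: "w - L_bracket a b u v \<in> Z_line"
    if "u $ X1 * v $ X2 - u $ X2 * v $ X1 = w $ Y1" "u $ X1 * v $ X3 - u $ X3 * v $ X1 = w $ Y2"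
      "u $ X2 * v $ X3 - u $ X3 * v $ X2 = w $ Y3" for v
    using that w'(1) by (simp add: Z_line_def L_derived_def L_bracket_nth)
  from u consider "u $ X1 \<noteq> 0" | "u $ X2 \<noteq> 0" | "u $ X3 \<noteq> 0" by (auto simp: L_derived_def)
  then show thesis
  proof cases
    case 1
    with w' show ?thesis
      \<comment> \<open>With \<open>v $ X1 = 0\<close> the first two equations of \<open>mem\<close>
        determine \<open>v\<close>, and the third is then \<open>wedge u w = 0\<close>. The other
        cases are analogous.\<close>
      by (intro that[OF mem, of "axis X2 (w $ Y1 / u $ X1) + axis X3 (w $ Y2 / u $ X1)"])
        (simp_all add: axis_nth_gen field_simps)
  next
    case 2
    with w' show ?thesis
      by (intro that[OF mem, of "axis X1 (- w $ Y1 / u $ X2) + axis X3 (w $ Y3 / u $ X2)"])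
        (simp_all add: axis_nth_gen field_simps)
  next
    case 3
    with w' show ?thesis
      by (intro that[OF mem, of "axis X1 (- w $ Y2 / u $ X3) + axis X2 (- w $ Y3 / u $ X3)"])
        (simp_all add: axis_nth_gen field_simps)
  qed
qed

lemma wedge_ker_subset_L_ideal:
  fixes I :: "('k::field ^ gen) set"
  assumes I: "L_ideal a b I" and u: "u \<in> I" "u \<notin> L_derived"
  shows "wedge_ker u \<subseteq> I"
proof -
  from I have sub: "vec.subspace I" and br: "\<And>x y. x \<in> I \<Longrightarrow> L_bracket a b x y \<in> I"
    by (auto simp: L_ideal_iff)
  \<comment> \<open>The z-coordinates of \<open>[[u, x_2], x_1]\<close>,
    \<open>[[u, x_1], x_1]\<close> and \<open>[[u, x_1], x_3]\<close> are \<open>u $ X1\<close>,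
    \<open>- u $ X2\<close> and \<open>- u $ X3\<close>, whatever \<open>a\<close> and
    \<open>b\<close> are.\<close>
  have "\<exists>v x. L_bracket a b (L_bracket a b u v) x $ Z \<noteq> 0"
  proof -
    from u consider "u $ X1 \<noteq> 0" | "u $ X2 \<noteq> 0" | "u $ X1 = 0" "u $ X2 = 0" "u $ X3 \<noteq> 0"
      by (auto simp: L_derived_def)
    then show ?thesis
    proof cases
      case 1
      then show ?thesis
        by (intro exI[of _ "e X2"] exI[of _ "e X1"]) (simp add: L_bracket_nth axis_nth_gen)
    next
      case 2
      then show ?thesis
        by (intro exI[of _ "e X1"] exI[of _ "e X1"]) (simp add: L_bracket_nth axis_nth_gen)
    next
      case 3
      then show ?thesis
        by (intro exI[of _ "e X1"] exI[of _ "e X3"]) (simp add: L_bracket_nth axis_nth_gen)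
    qed
  qed
  then obtain v x where "L_bracket a b (L_bracket a b u v) x $ Z \<noteq> 0" by blast
  then have Z: "Z_line \<subseteq> I"
    using Z_line_subsetI[OF sub br[OF br[OF u(1)]] L_bracket_in_Z_line[OF L_bracket_in_L_derived]]
    by blast
  show "wedge_ker u \<subseteq> I"
  proof
    fix w assume "w \<in> wedge_ker u"
    then obtain v where v: "w - L_bracket a b u v \<in> Z_line"
      using wedge_ker_cover u(2) by blast
    with Z have "(w - L_bracket a b u v) + L_bracket a b u v \<in> I"
      using sub br[OF u(1)] vec.subspace_add by blast
    then show "w \<in> I" by simp
  qed
qed

lemma L_ideal_eq_L_wedge_ideal:
  fixes I :: "('k::field ^ gen) set"
  assumes I: "L_ideal a b I" and u: "u \<in> I" "u \<notin> L_derived" and nd: "\<not> L_derived \<subseteq> I"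
  shows "I = L_wedge_ideal u"
proof (intro equalityI subsetI)
  from I have sub: "vec.subspace I" and br: "\<And>x y. x \<in> I \<Longrightarrow> L_bracket a b x y \<in> I"
    by (auto simp: L_ideal_iff)
  note K = wedge_ker_subset_L_ideal[OF I u]
  \<comment> \<open>As \<open>wedge_ker u\<close> is a hyperplane of \<open>L'\<close> inside
    \<open>I\<close>, one more vector of \<open>L'\<close> in \<open>I\<close> would force all of
    \<open>L'\<close> into \<open>I\<close>.\<close>
  have wedge0: "wedge u w = 0" if w: "w \<in> I" "w \<in> L_derived" for w
  proof (rule ccontr)
    assume nz: "wedge u w \<noteq> 0"
    have "v \<in> I" if "v \<in> L_derived" for v
    proof -
      let ?c = "wedge u v / wedge u w"
      have "v - ?c *s w \<in> wedge_ker u"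
        using that w nz
        by (simp add: wedge_ker_def wedge_minus_scale vec.subspace_diff vec.subspace_scale subspace_L_derived)
      with K w sub have "(v - ?c *s w) + ?c *s w \<in> I"
        by (meson subsetD vec.subspace_add vec.subspace_scale)
      then show ?thesis by simp
    qed
    with nd show False by blast
  qed
  fix v assume v: "v \<in> I"
  text \<open>The vanishing wedge products of \<open>u\<close> with \<open>[v, x\<^sub>i]\<close> are the \<open>2 \<times> 2\<close> minors
    of \<open>u\<close> and \<open>v\<close> modulo \<open>L'\<close>.\<close>
  have "wedge u (L_bracket a b v y) = 0" for y
    using wedge0 br[OF v] L_bracket_in_L_derived by blast
  from this[of "e X1"] this[of "e X2"] this[of "e X3"]
  have minors: "u $ X2 * v $ X3 = u $ X3 * v $ X2" "u $ X1 * v $ X3 = u $ X3 * v $ X1"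
    "u $ X1 * v $ X2 = u $ X2 * v $ X1"
    by (simp_all add: wedge_def L_bracket_nth axis_nth_gen algebra_simps)
  \<comment> \<open>Vanishing minors make \<open>v\<close> proportional to \<open>u\<close> modulo
    \<open>L'\<close>; the factor is read off at a nonzero coordinate of \<open>u\<close>.\<close>
  obtain c where "v - c *s u \<in> L_derived"
  proof -
    from u consider "u $ X1 \<noteq> 0" | "u $ X2 \<noteq> 0" | "u $ X3 \<noteq> 0" by (auto simp: L_derived_def)
    then show thesis
    proof cases
      case 1
      with minors show ?thesis
        by (intro that[of "v $ X1 / u $ X1"]) (simp add: L_derived_def field_simps)
    next
      case 2
      with minors show ?thesis
        by (intro that[of "v $ X2 / u $ X2"]) (simp add: L_derived_def field_simps)
    next
      case 3
      with minors show ?thesis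
        by (intro that[of "v $ X3 / u $ X3"]) (simp add: L_derived_def field_simps)
    qed
  qed
  moreover have "v - c *s u \<in> I" using v u sub by (simp add: vec.subspace_diff vec.subspace_scale)
  ultimately show "v \<in> L_wedge_ideal u"
    using wedge0 by (auto simp: mem_L_wedge_ideal wedge_ker_def)
next
  fix v assume "v \<in> L_wedge_ideal u"
  moreover have "L_wedge_ideal u \<subseteq> I"
    unfolding L_wedge_ideal_def
    using I u wedge_ker_subset_L_ideal[OF I u] by (intro vec.span_minimal) (auto simp: L_ideal_iff)
  ultimately show "v \<in> I" by blast
qed

section \<open>The remaining ideals and the classification\<close>

lemma L_ideal_in_L_derived:
  fixes I :: "('k::field ^ gen) set"
  assumes I: "L_ideal a b I" and "I \<subseteq> L_derived" and "\<not> I \<subseteq> L_centre a b"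
  shows "Z_line \<subseteq> I"
proof -
  from I have sub: "vec.subspace I" and br: "\<And>x y. x \<in> I \<Longrightarrow> L_bracket a b x y \<in> I"
    by (auto simp: L_ideal_iff)
  obtain u where u: "u \<in> I" "u \<in> L_derived" "u \<notin> L_centre a b" using assms by blast
  \<comment> \<open>A failing equation of \<open>L_centre\<close> names the \<open>x_i\<close> whose
    bracket with \<open>u\<close> is a nonzero multiple of z.\<close>
  then have "\<exists>x. L_bracket a b u (e x) $ Z \<noteq> 0"
    by (auto simp: L_centre_def L_derived_def L_bracket_nth axis_nth_gen
      intro: exI[of _ X1] exI[of _ X2] exI[of _ X3])
  then show ?thesis
    using Z_line_subsetI[OF sub br[OF u(1)] L_bracket_in_Z_line[OF u(2)]] by blast
qed

text \<open>Write an element as \<open>k + c *s u\<close> with \<open>k\<close> in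
  \<open>wedge_ker u\<close>. Then \<open>[k, y]\<close> lies in \<open>Z\<close> and
  \<open>[u, y]\<close> in \<open>wedge_ker u\<close>, which contains \<open>Z\<close>.\<close>

lemma L_ideal_L_wedge_ideal: "L_ideal a b (L_wedge_ideal u)"
proof -
  have "L_bracket a b v y \<in> L_wedge_ideal u" if v: "v \<in> L_wedge_ideal u" for v y
  proof -
    interpret lie_algebra "(*s)" "L_bracket a b" by (rule L_lie_algebra)
    from v obtain c where c: "v - c *s u \<in> wedge_ker u" by (auto simp: mem_L_wedge_ideal)
    have "L_bracket a b (v - c *s u) y \<in> wedge_ker u"
      using c wedge_ker_subset_L_derived L_bracket_in_Z_line Z_line_subset_wedge_ker by blast
    moreover have "c *s L_bracket a b u y \<in> wedge_ker u"
      using L_bracket_in_wedge_ker subspace_wedge_ker vec.subspace_scale by blast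
    ultimately have "L_bracket a b (v - c *s u) y + c *s L_bracket a b u y \<in> wedge_ker u"
      using subspace_wedge_ker vec.subspace_add by blast
    also have "L_bracket a b (v - c *s u) y + c *s L_bracket a b u y = L_bracket a b v y"
      by (metis bracket_add_left bracket_scale_left diff_add_cancel)
    finally show ?thesis by (simp add: L_wedge_ideal_def vec.span_base)
  qed
  then show ?thesis by (simp add: L_ideal_iff) (simp add: L_wedge_ideal_def)
qed

text \<open>This reduces counting ideals to counting subspaces. The four cases overlap, so the count
  has to be sorted by dimension.\<close>

lemma L_ideal_classification:
  "L_ideal a b I \<longleftrightarrow> vec.subspace I \<and> (L_derived \<subseteq> I \<or> (Z_line \<subseteq> I \<and> I \<subseteq> L_derived)
    \<or> I \<subseteq> L_centre a b \<or> (\<exists>u. u \<notin> L_derived \<and> I = L_wedge_ideal u))"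
  (is "_ \<longleftrightarrow> ?S \<and> ?R")
proof
  assume I: "L_ideal a b I"
  have ?R
  proof (cases "I \<subseteq> L_derived")
    case True
    with L_ideal_in_L_derived[OF I] show ?thesis by blast
  next
    case False
    then obtain u where "u \<in> I" "u \<notin> L_derived" by blast
    with L_ideal_eq_L_wedge_ideal[OF I] show ?thesis by blast
  qed
  with I show "?S \<and> ?R" by (simp add: L_ideal_iff)
next
  assume "?S \<and> ?R"
  then have S: ?S and ?R by auto
  from \<open>?R\<close> consider "L_derived \<subseteq> I" | "Z_line \<subseteq> I" "I \<subseteq> L_derived" | "I \<subseteq> L_centre a b"
    | u where "I = L_wedge_ideal u" by blast
  then show "L_ideal a b I"
  proof cases
    case 1
    then show ?thesis using S L_bracket_in_L_derived[of a b] by (auto simp: L_ideal_iff)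
  next
    case 2
    then show ?thesis using S L_bracket_in_Z_line[of _ a b] by (auto simp: L_ideal_iff)
  next
    case 3
    then have "L_bracket a b u v = 0" if "u \<in> I" for u v
      using that L_bracket_L_centre by blast
    then show ?thesis using S by (simp add: L_ideal_iff vec.subspace_0)
  next
    case 4
    then show ?thesis by (simp add: L_ideal_L_wedge_ideal)
  qed
qed

section \<open>Counting the ideals\<close>

lemma dim_L_centre:
  fixes a b :: "'k::field"
  shows "vec.dim (L_centre a b) = (if b = 0 then 2 else 1)"
proof (cases "b = 0")
  case True
  \<comment> \<open>For \<open>b = 0\<close> the only equations left are \<open>u $ Y1 = 0\<close>
    and \<open>u $ Y2 = - a * u $ Y3\<close>, solved modulo \<open>Z\<close> by the multiples of
    \<open>?c\<close>.\<close>
  let ?c = "e Y3 - a *s e Y2"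
  have "vec.span (insert ?c Z_line) = L_centre a b"
  proof (intro equalityI subsetI)
    fix v assume "v \<in> vec.span (insert ?c Z_line)"
    moreover have "?c \<in> L_centre a b"
      using True by (simp add: L_centre_def L_derived_def axis_nth_gen)
    then have "vec.span (insert ?c Z_line) \<subseteq> L_centre a b"
      using Z_line_subset_L_centre subspace_L_centre by (intro vec.span_minimal) auto
    ultimately show "v \<in> L_centre a b" by blast
  next
    fix v assume "v \<in> L_centre a b"
    then have "v - v $ Y3 *s ?c \<in> Z_line"
      by (auto simp: L_centre_def L_derived_def Z_line_def axis_nth_gen algebra_simps)
    then show "v \<in> vec.span (insert ?c Z_line)"
      unfolding vec.span_insert using vec.span_base by blast
  qed
  moreover have "?c \<notin> Z_line" by (simp add: Z_line_def axis_nth_gen)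
  ultimately show ?thesis
    using True dim_span_insert[OF _ subspace_Z_line, of ?c] dim_Z_line[where 'k='k] by simp
next
  case False
  then have "L_centre a b = Z_line" by (auto simp: L_centre_def Z_line_def)
  with False show ?thesis by (simp add: dim_Z_line)
qed

text \<open>These ideals partition the \<open>q ^ 7 - q ^ 4\<close> vectors outside
  \<open>L'\<close>, and each contains \<open>q ^ 4 - q ^ 3\<close> of them.\<close>

lemma card_L_wedge_ideals:
  fixes q :: nat
  defines "q \<equiv> CARD('k::{field,finite})"
  shows "card {L_wedge_ideal u :: ('k ^ gen) set | u. u \<notin> L_derived} = q + q\<^sup>2 + q ^ 3"
    (is "card ?F = _")
proof -
  have "card ?F * (q ^ 4 - q ^ 3) = card (UNIV - L_derived :: ('k ^ gen) set)"
  proof (rule card_mult_eq_of_unique)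
    fix I :: "('k ^ gen) set" assume "I \<in> ?F"
    then obtain v where v: "v \<notin> L_derived" "I = L_wedge_ideal v" by blast
    then have I: "vec.subspace I" "vec.dim I = 4"
      by (auto simp: dim_L_wedge_ideal) (simp add: L_wedge_ideal_def)
    have "{u \<in> UNIV - L_derived. u \<in> I} = I - I \<inter> L_derived" by blast
    also have "I \<inter> L_derived = wedge_ker v"
      using v by (simp add: L_wedge_ideal_Int_L_derived)
    finally have "{u \<in> UNIV - L_derived. u \<in> I} = I - wedge_ker v" .
    moreover have "wedge_ker v \<subseteq> I" using v L_wedge_ideal_Int_L_derived by blast
    ultimately show "card {u \<in> UNIV - L_derived. u \<in> I} = q ^ 4 - q ^ 3"
      using I v
      by (simp add: card_Diff_subset card_subspace subspace_wedge_ker dim_wedge_ker q_def)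
  next
    fix u :: "'k ^ gen" assume u: "u \<in> UNIV - L_derived"
    show "\<exists>!I. I \<in> ?F \<and> u \<in> I"
    proof (rule ex1I[of _ "L_wedge_ideal u"])
      have "u \<in> L_wedge_ideal u" by (simp add: L_wedge_ideal_def vec.span_base)
      with u show "L_wedge_ideal u \<in> ?F \<and> u \<in> L_wedge_ideal u" by blast
    next
      fix I assume I: "I \<in> ?F \<and> u \<in> I"
      then obtain v where v: "v \<notin> L_derived" "I = L_wedge_ideal v" by blast
      \<comment> \<open>Needed for \<open>L_ideal_eq_L_wedge_ideal\<close>: the intersection of
        \<open>I\<close> with \<open>L'\<close> has dimension 3 only.\<close>
      have "\<not> L_derived \<subseteq> I"
      proof
        assume "L_derived \<subseteq> I"
        with v have "L_derived = wedge_ker v" using L_wedge_ideal_Int_L_derived by blast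
        then show False using dim_wedge_ker[OF v(1)] dim_L_derived[where 'k='k] by simp
      qed
      then show "I = L_wedge_ideal u"
        using L_ideal_eq_L_wedge_ideal[OF L_ideal_L_wedge_ideal] I u v by blast
    qed
  qed auto
  also have "\<dots> = q ^ 7 - q ^ 4"
    using card_subspace[OF subspace_L_derived, where 'k='k]
      card_subspace[OF vec.subspace_UNIV, where 'k='k and 'n=gen]
    by (simp add: card_Diff_subset dim_L_derived card_cart_basis CARD_gen q_def)
  also have "\<dots> = (q + q\<^sup>2 + q ^ 3) * (q ^ 4 - q ^ 3)"
    by (simp add: algebra_simps diff_mult_distrib2 flip: power_add) (simp add: numeral_eq_Suc)
  finally have "card ?F * (q ^ 4 - q ^ 3) = (q + q\<^sup>2 + q ^ 3) * (q ^ 4 - q ^ 3)" .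
  moreover have "q ^ 3 < q ^ 4"
    using card_ge_2_field[where 'k='k] by (intro power_strict_increasing) (auto simp: q_def)
  ultimately show ?thesis by simp
qed

text \<open>Dimension 1 counts lines of the centre, dimensions 2 and 3 count lines and planes of
  \<open>L' / Z\<close>, and 5 and 6 those of \<open>L / L'\<close>. Both quotients have dimension
  3.\<close>

lemma card_L_ideals_dim:
  fixes a b :: "'k::{field,finite}" and q :: nat and N :: "nat \<Rightarrow> nat"
  defines "q \<equiv> CARD('k)"
    and "N \<equiv> \<lambda>d. card {I. L_ideal a b I \<and> vec.dim I = d}"
  shows "N 0 = 1" "N 1 = (if b = 0 then 1 + q else 1)" "N 2 = 1 + q + q\<^sup>2" "N 3 = 1 + q + q\<^sup>2"
    "N 4 = 1 + q + q\<^sup>2 + q ^ 3" "N 5 = 1 + q + q\<^sup>2" "N 6 = 1 + q + q\<^sup>2" "N 7 = 1"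
proof -
  let ?P = "\<lambda>A B d. {I :: ('k ^ gen) set. vec.subspace I \<and> A \<subseteq> I \<and> I \<subseteq> B \<and> vec.dim I = d}"
  have dims: "vec.dim (L_derived :: ('k ^ gen) set) = 4" "vec.dim (Z_line :: ('k ^ gen) set) = 1"
    "vec.dim (UNIV :: ('k ^ gen) set) = 7" "vec.dim (L_centre a b) = (if b = 0 then 2 else 1)"
    by (fact dim_L_derived dim_Z_line L_dim dim_L_centre)+
  note subs = subspace_L_derived subspace_Z_line subspace_L_centre vec.subspace_UNIV
  have not_wedge: "I \<noteq> L_wedge_ideal u" if "vec.dim I \<noteq> 4" "u \<notin> L_derived"
    for I and u :: "'k ^ gen"
    using that dim_L_wedge_ideal by blast
  have not_derived: "\<not> L_derived \<subseteq> I" if "vec.dim I < 4" for I :: "('k ^ gen) set"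
    using vec.dim_subset[of L_derived I] that dims by auto
  have large: "{I. L_ideal a b I \<and> vec.dim I = d} = ?P L_derived UNIV d" if "d > 4" for d
  proof (intro Collect_cong)
    fix I :: "('k ^ gen) set"
    have "\<not> I \<subseteq> L_derived" if "vec.dim I = d"
      using vec.dim_subset[of I L_derived] that \<open>d > 4\<close> dims by auto
    moreover have "d \<noteq> 4" using \<open>d > 4\<close> by simp
    ultimately show "L_ideal a b I \<and> vec.dim I = d \<longleftrightarrow>
        vec.subspace I \<and> L_derived \<subseteq> I \<and> I \<subseteq> UNIV \<and> vec.dim I = d"
      unfolding L_ideal_classification
      using not_wedge L_centre_subset_L_derived by blast
  qed
  have mid: "{I. L_ideal a b I \<and> vec.dim I = d} = ?P Z_line L_derived d" if "d = 2 \<or> d = 3" for d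
  proof (intro Collect_cong)
    fix I :: "('k ^ gen) set"
    have "\<not> L_derived \<subseteq> I" if "vec.dim I = d"
      using that \<open>d = 2 \<or> d = 3\<close> not_derived by auto
    \<comment> \<open>The centre has dimension at most 2, so a subspace of it of dimension at least
      2 is the whole centre.\<close>
    moreover have "Z_line \<subseteq> I" if "I \<subseteq> L_centre a b" "vec.dim I = d" "vec.subspace I"
    proof -
      have "I = L_centre a b"
        using that \<open>d = 2 \<or> d = 3\<close> dims subspace_L_centre
        by (intro vec.subspace_dim_equal) (auto split: if_splits)
      then show ?thesis using Z_line_subset_L_centre by blast
    qed
    moreover have "d \<noteq> 4" using \<open>d = 2 \<or> d = 3\<close> by auto
    ultimately show "L_ideal a b I \<and> vec.dim I = d \<longleftrightarrow>
        vec.subspace I \<and> Z_line \<subseteq> I \<and> I \<subseteq> L_derived \<and> vec.dim I = d"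
      unfolding L_ideal_classification
      using not_wedge L_centre_subset_L_derived by blast
  qed
  have small: "{I. L_ideal a b I \<and> vec.dim I = d} = ?P {0} (L_centre a b) d" if "d < 2" for d
  proof (intro Collect_cong)
    fix I :: "('k ^ gen) set"
    have "\<not> L_derived \<subseteq> I" if "vec.dim I = d"
      using that \<open>d < 2\<close> not_derived by auto
    \<comment> \<open>An ideal of dimension at most 1 above \<open>Z\<close> is \<open>Z\<close>
      itself, hence central.\<close>
    moreover have "I \<subseteq> L_centre a b" if "Z_line \<subseteq> I" "vec.dim I = d" "vec.subspace I"
    proof -
      have "Z_line = I"
        using that \<open>d < 2\<close> dims subspace_Z_line by (intro vec.subspace_dim_equal) auto
      then show ?thesis using Z_line_subset_L_centre by blast
    qed
    moreover have "{0} \<subseteq> I" if "vec.subspace I" using that vec.subspace_0 by blast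
    moreover have "d \<noteq> 4" using \<open>d < 2\<close> by auto
    ultimately show "L_ideal a b I \<and> vec.dim I = d \<longleftrightarrow>
        vec.subspace I \<and> {0} \<subseteq> I \<and> I \<subseteq> L_centre a b \<and> vec.dim I = d"
      unfolding L_ideal_classification using not_wedge by blast
  qed
  have four: "{I. L_ideal a b I \<and> vec.dim I = 4} =
      insert L_derived {L_wedge_ideal u | u. u \<notin> L_derived}"
  proof -
    \<comment> \<open>In dimension 4 every case of the classification except the wedge ideals
      collapses to \<open>L'\<close>.\<close>
    have eq: "I = L_derived"
      if "L_derived \<subseteq> I \<or> I \<subseteq> L_derived" "vec.dim I = 4" "vec.subspace I"
      for I :: "('k ^ gen) set"
      using that dims subspace_L_derived vec.subspace_dim_equal[of I L_derived]
        vec.subspace_dim_equal[of L_derived I] by auto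
    have "I = L_derived \<or> (\<exists>u. u \<notin> L_derived \<and> I = L_wedge_ideal u)"
      if "L_ideal a b I" "vec.dim I = 4" for I :: "('k ^ gen) set"
    proof -
      have "vec.subspace I" using that by (simp add: L_ideal_iff)
      with that eq have "I = L_derived" if "L_derived \<subseteq> I \<or> I \<subseteq> L_derived" using that by blast
      with \<open>L_ideal a b I\<close> show ?thesis
        using L_centre_subset_L_derived unfolding L_ideal_classification by blast
    qed
    moreover have "L_ideal a b L_derived"
      by (simp add: L_ideal_classification subspace_L_derived)
    ultimately show ?thesis
      using dims(1) dim_L_wedge_ideal[where 'k='k] L_ideal_L_wedge_ideal by auto
  qed
  have dim0: "vec.subspace I \<and> vec.dim I = 0 \<longleftrightarrow> I = {0}" for I :: "('k ^ gen) set"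
    using vec.subspace_0 by (auto simp: subset_singleton_iff)
  then have "?P {0} (L_centre a b) 0 = {{0}}"
    using vec.subspace_0[OF subspace_L_centre] by auto
  then show "N 0 = 1" unfolding N_def by (subst small) simp_all
  have "N 1 = (\<Sum>i<if b = 0 then 2 else 1. q ^ i)"
    using card_subspaces_Suc_dim[of "{0}" "L_centre a b" "if b = 0 then 2 else 1"]
      vec.subspace_0[OF subspace_L_centre[of a b]] dims(4)
    unfolding N_def by (subst small) (simp_all add: subs q_def split del: if_split)
  then show "N 1 = (if b = 0 then 1 + q else 1)" by (simp add: numeral_2_eq_2)
  show "N 2 = 1 + q + q\<^sup>2"
    using card_subspaces_Suc_dim[of "Z_line :: ('k ^ gen) set" L_derived 3] dims
    unfolding N_def
    by (subst mid) (simp_all add: subs q_def Z_line_subset_L_derived numeral_eq_Suc)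
  show "N 3 = 1 + q + q\<^sup>2"
    using card_subspaces_Suc_Suc_dim[of "Z_line :: ('k ^ gen) set" L_derived] dims
    unfolding N_def by (subst mid) (simp_all add: subs q_def Z_line_subset_L_derived numeral_3_eq_3)
  show "N 5 = 1 + q + q\<^sup>2"
    using card_subspaces_Suc_dim[of "L_derived :: ('k ^ gen) set" UNIV 3] dims
    unfolding N_def by (subst large) (simp_all add: subs q_def numeral_eq_Suc)
  show "N 6 = 1 + q + q\<^sup>2"
    using card_subspaces_Suc_Suc_dim[of "L_derived :: ('k ^ gen) set" UNIV] dims
    unfolding N_def by (subst large) (simp_all add: subs q_def)
  have "?P L_derived UNIV 7 = {UNIV}"
  proof (intro equalityI subsetI)
    fix I assume "I \<in> ?P L_derived UNIV 7"
    then have "I = UNIV" using dims(3) by (intro vec.subspace_dim_equal) auto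
    then show "I \<in> {UNIV}" by simp
  qed (use dims(3) in simp)
  moreover have "N 7 = card (?P L_derived UNIV 7)" unfolding N_def by (subst large) simp_all
  ultimately show "N 7 = 1" by simp
  \<comment> \<open>Since \<open>L_wedge_ideal u\<close> contains \<open>u\<close>, it differs from
    \<open>L'\<close>, which therefore adds one to the count.\<close>
  have "L_derived \<noteq> L_wedge_ideal u" if "u \<notin> L_derived" for u :: "'k ^ gen"
    using that vec.span_base[of u "insert u (wedge_ker u)"] by (auto simp: L_wedge_ideal_def)
  then have "(L_derived :: ('k ^ gen) set) \<notin> {L_wedge_ideal u | u. u \<notin> L_derived}" by blast
  then have "N 4 = Suc (q + q\<^sup>2 + q ^ 3)"
    unfolding N_def four q_def card_L_wedge_ideals[symmetric] by (intro card_insert_disjoint) simp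
  then show "N 4 = 1 + q + q\<^sup>2 + q ^ 3" by simp
qed

section \<open>From dimensions to codimensions: the zeta function\<close>

lemma L_ideal_zeta:
  fixes a b :: "'p::prime_card mod_ring" and s :: complex
  defines "p \<equiv> CARD('p)" and "t \<equiv> of_nat CARD('p) powr (- s)"
  shows "Fp_lie_algebra.ideal_zeta (*s) (L_bracket a b) s =
    1 + of_nat (1 + p + p\<^sup>2) * t + of_nat (1 + p + p\<^sup>2) * t\<^sup>2
      + of_nat (1 + p + p\<^sup>2 + p ^ 3) * t ^ 3 + of_nat (1 + p + p\<^sup>2) * t ^ 4
      + of_nat (1 + p + p\<^sup>2) * t ^ 5 + of_nat (if b = 0 then 1 + p else 1) * t ^ 6 + t ^ 7"
proof -
  interpret Fp_lie_algebra "(*s)" "L_bracket a b" by (rule L_Fp_lie_algebra)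
  have num: "num_ideals_codim i = card {I. L_ideal a b I \<and> vec.dim I = d}" if "d + i = 7" for d i
  proof -
    have "vec.dim I + i = 7 \<longleftrightarrow> vec.dim I = d" for I :: "('p mod_ring ^ gen) set"
      using that by auto
    then show ?thesis by (simp only: num_ideals_codim_def L_dim)
  qed
  note N = card_L_ideals_dim[of a b, unfolded CARD_mod_ring, folded p_def]
  have codim: "num_ideals_codim 0 = 1" "num_ideals_codim 1 = 1 + p + p\<^sup>2"
    "num_ideals_codim 2 = 1 + p + p\<^sup>2" "num_ideals_codim 3 = 1 + p + p\<^sup>2 + p ^ 3"
    "num_ideals_codim 4 = 1 + p + p\<^sup>2" "num_ideals_codim 5 = 1 + p + p\<^sup>2"
    "num_ideals_codim 6 = (if b = 0 then 1 + p else 1)" "num_ideals_codim 7 = 1"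
    by (rule trans[OF num N(8)] trans[OF num N(7)] trans[OF num N(6)] trans[OF num N(5)]
      trans[OF num N(4)] trans[OF num N(3)] trans[OF num N(2)] trans[OF num N(1)]; simp)+
  have "{0..7} = {0, 1, 2, 3, 4, 5, 6, 7 :: nat}" by auto
  then have "(\<Sum>i = 0..7. f i) = f 0 + f 1 + f 2 + f 3 + f 4 + f 5 + f 6 + f 7"
    for f :: "nat \<Rightarrow> complex" by (simp add: add.assoc)
  then show ?thesis
    unfolding ideal_zeta_def L_dim t_def[symmetric] by (simp only: codim power_0 power_one_right mult_1_right mult_1_left of_nat_1)
qed

theorem theorem4p8:
  fixes p :: nat and a b :: "'p::prime_card mod_ring"
  assumes "p = CARD('p)" and "p > 3"
  shows
    "(b \<noteq> 0 \<longrightarrow> (\<forall>s::complex. let t = of_nat p powr (- s) in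
        Fp_lie_algebra.ideal_zeta (*s) (L_bracket a b) s =
          1 + of_nat (1 + p + p^2) * t + of_nat (1 + p + p^2) * t^2
            + of_nat (1 + p + p^2 + p^3) * t^3 + of_nat (1 + p + p^2) * t^4
            + of_nat (1 + p + p^2) * t^5 + t^6 + t^7))
     \<and> (b = 0 \<longrightarrow> (\<forall>s::complex. let t = of_nat p powr (- s) in
        Fp_lie_algebra.ideal_zeta (*s) (L_bracket a b) s =
          1 + of_nat (1 + p + p^2) * t + of_nat (1 + p + p^2) * t^2
            + of_nat (1 + p + p^2 + p^3) * t^3 + of_nat (1 + p + p^2) * t^4
            + of_nat (1 + p + p^2) * t^5 + of_nat (1 + p) * t^6 + t^7))"
  by (simp add: assms(1) L_ideal_zeta Let_def)

end
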